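(* Suppose that $m(X,\theta)=A(X)+d\cdot\theta$ for $\theta\in\Theta$, with a constant $d\neq0$, and let $p(X)$ be an unbiased predictor of $Y$ of the form $p(X)=A(X)+d\cdot\overline{\theta}(X)$. For some $\theta_0\in\Theta$ and $\alpha\in(0,1)$, consider $$p_0(X)=\alpha\,p(X)+(1-\alpha)\,m(X,\theta_0).$$ Then, at each $\theta\in\Theta$, $$p_0\prec p\quad\Longleftrightarrow\quad|\theta-\theta_0|\le\Big(\frac{1+\alpha}{1-\alpha}\Big)^{1/2}\Big(\mathbb{E}_\theta\big(\overline{\theta}(X)-\theta\big)^2\Big)^{1/2},$$ where $p_0\prec p$ at $\theta$ means $\mathbb{E}_\theta(p_0(X)-Y)^2\le\mathbb{E}_\theta(p(X)-Y)^2$.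
   Context: $(X,Y)$ is a random vector with values in $(F\times G,\mathcal{F}\otimes\mathcal{G})$, with $Y$ real valued, whose distribution belongs to a family $(\mathbb{P}_\theta,\theta\in\Theta)$, with $\Theta\subset\mathbb{R}$ open. $\mathbb{E}_\theta$ and $\mathbb{E}_\theta(\cdot\mid X)$ denote expectation and conditional expectation under $\mathbb{P}_\theta$, and $m(X,\theta)=\mathbb{E}_\theta(Y\mid X)$. $A(X)$ and $\overline{\theta}(X)$ are real measurable functions of $X$ not depending on $\theta$. $Y$ and the predictors $p(X)$, $p_0(X)$ are square integrable under each $\mathbb{P}_\theta$. A predictor $p(X)$ of $Y$ is unbiased if $\mathbb{E}_\theta\,p(X)=\mathbb{E}_\theta(Y)$ for all $\theta\in\Theta$. *)

theory Defs
  imports "HOL-Probability.Probability"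
begin

text \<open>
  The underlying sample space is arbitrary; \<open>X\<close> takes values in the measurable space \<open>F\<close>, \<open>Y\<close> is
  real valued, and \<open>P \<theta>\<close> is the probability measure on the sample space with parameter \<open>\<theta>\<close>.
  Predictors are functions \<open>p\<close> on \<open>F\<close>, evaluated as \<open>p (X \<omega>)\<close>.
\<close>

definition cond_exp_given ::
  "'w measure \<Rightarrow> 'f measure \<Rightarrow> ('w \<Rightarrow> 'f) \<Rightarrow> ('w \<Rightarrow> real) \<Rightarrow> 'w \<Rightarrow> real" where
  "cond_exp_given M F X Y = real_cond_exp M (vimage_algebra (space M) X F) Y"

text \<open>
  \<open>m x \<theta>\<close> is a version of the conditional expectation of \<open>Y\<close> given \<open>X = x\<close> under \<open>P \<theta>\<close>. A version is
  determined only up to \<open>P \<theta>\<close>-null sets, so a formula for \<open>m (X \<omega>) \<theta>\<close> that is to be used under another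
  \<open>P \<theta>'\<close> has to be assumed almost everywhere for \<open>P \<theta>'\<close> as well.
\<close>

definition regression_function ::
  "real set \<Rightarrow> (real \<Rightarrow> 'w measure) \<Rightarrow> 'f measure \<Rightarrow> ('w \<Rightarrow> 'f) \<Rightarrow> ('w \<Rightarrow> real) \<Rightarrow>
   ('f \<Rightarrow> real \<Rightarrow> real) \<Rightarrow> bool" where
  "regression_function \<Theta> P F X Y m \<longleftrightarrow>
     (\<forall>\<theta>\<in>\<Theta>. (\<lambda>x. m x \<theta>) \<in> borel_measurable F \<and>
             (AE \<omega> in P \<theta>. m (X \<omega>) \<theta> = cond_exp_given (P \<theta>) F X Y \<omega>))"

definition square_integrable :: "'w measure \<Rightarrow> ('w \<Rightarrow> real) \<Rightarrow> bool" where
  "square_integrable M Z \<longleftrightarrow> Z \<in> borel_measurable M \<and> integrable M (\<lambda>\<omega>. (Z \<omega>)\<^sup>2)"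

definition unbiased_predictor ::
  "real set \<Rightarrow> (real \<Rightarrow> 'w measure) \<Rightarrow> ('w \<Rightarrow> 'f) \<Rightarrow> ('w \<Rightarrow> real) \<Rightarrow> ('f \<Rightarrow> real) \<Rightarrow> bool" where
  "unbiased_predictor \<Theta> P X Y p \<longleftrightarrow>
     (\<forall>\<theta>\<in>\<Theta>. (\<integral>\<omega>. p (X \<omega>) \<partial>P \<theta>) = (\<integral>\<omega>. Y \<omega> \<partial>P \<theta>))"

text \<open>The relation \<open>p\<^sub>0 \<prec> p\<close> at the parameter value whose measure is \<open>M\<close>; it is not strict.\<close>

definition preferable ::
  "'w measure \<Rightarrow> ('w \<Rightarrow> 'f) \<Rightarrow> ('w \<Rightarrow> real) \<Rightarrow> ('f \<Rightarrow> real) \<Rightarrow> ('f \<Rightarrow> real) \<Rightarrow> bool" where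
  "preferable M X Y p\<^sub>0 p \<longleftrightarrow>
     (\<integral>\<omega>. (p\<^sub>0 (X \<omega>) - Y \<omega>)\<^sup>2 \<partial>M) \<le> (\<integral>\<omega>. (p (X \<omega>) - Y \<omega>)\<^sup>2 \<partial>M)"

end

theory Submission
  imports Defs
begin

text \<open>
  Fix \<open>\<theta>\<close> and split both prediction errors along the residual \<open>R = m (X, \<theta>) - Y\<close>, with
  \<open>D = \<theta>bar (X) - \<theta>\<close>:
  \<open>p (X) - Y = d D + R\<close> and \<open>p\<^sub>0 (X) - Y = \<alpha> d D + (1 - \<alpha>) d (\<theta>\<^sub>0 - \<theta>) + R\<close>.
  As \<open>R\<close> is the residual of a conditional expectation given \<open>X\<close>, it is orthogonal to every square
  integrable function of \<open>X\<close>, hence to \<open>D\<close> and to the constants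
  (\<open>integral_times_cond_exp_given\<close>). Unbiasedness of \<open>p\<close> together with \<open>d \<noteq> 0\<close> makes \<open>D\<close> centred,
  that is, orthogonal to the constants as well. So \<open>D\<close>, \<open>1\<close> and \<open>R\<close> are pairwise orthogonal, and
  Pythagoras (\<open>integral_square_orthogonal_sum\<close>) gives the two risks
  \<open>d\<^sup>2 E D\<^sup>2 + E R\<^sup>2\<close> and \<open>\<alpha>\<^sup>2 d\<^sup>2 E D\<^sup>2 + (1 - \<alpha>)\<^sup>2 d\<^sup>2 (\<theta> - \<theta>\<^sub>0)\<^sup>2 + E R\<^sup>2\<close>. The common term
  \<open>E R\<^sup>2\<close> cancels, and so does \<open>d\<^sup>2 (1 - \<alpha>)\<close>; what is left is
  \<open>(1 - \<alpha>) (\<theta> - \<theta>\<^sub>0)\<^sup>2 \<le> (1 + \<alpha>) E D\<^sup>2\<close>, and the claim follows by taking square roots.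
\<close>

lemma square_integrable_measurable:
  "square_integrable M f \<Longrightarrow> f \<in> borel_measurable M"
  by (simp add: square_integrable_def)

lemma square_integrable_integrable_mult:
  assumes f: "square_integrable M f" and g: "square_integrable M g"
  shows "integrable M (\<lambda>\<omega>. f \<omega> * g \<omega>)"
proof (rule Bochner_Integration.integrable_bound)
  show "integrable M (\<lambda>\<omega>. (f \<omega>)\<^sup>2 + (g \<omega>)\<^sup>2)"
    using f g by (simp add: square_integrable_def)
  show "(\<lambda>\<omega>. f \<omega> * g \<omega>) \<in> borel_measurable M"
    using f g by (auto simp: square_integrable_def)
  have "\<bar>a * b\<bar> \<le> a\<^sup>2 + b\<^sup>2" for a b :: real
    using sum_squares_bound[of "\<bar>a\<bar>" "\<bar>b\<bar>"] abs_ge_zero[of "a * b"]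
    unfolding abs_mult power2_abs by linarith
  then show "AE \<omega> in M. norm (f \<omega> * g \<omega>) \<le> norm ((f \<omega>)\<^sup>2 + (g \<omega>)\<^sup>2)"
    by simp
qed

lemma square_integrable_const:
  "finite_measure M \<Longrightarrow> square_integrable M (\<lambda>_. c)"
  by (simp add: square_integrable_def finite_measure.integrable_const)

lemma square_integrable_integrable:
  "finite_measure M \<Longrightarrow> square_integrable M f \<Longrightarrow> integrable M f"
  by (simp add: square_integrable_def finite_measure.square_integrable_imp_integrable)

lemma square_integrable_cmult:
  "square_integrable M f \<Longrightarrow> square_integrable M (\<lambda>\<omega>. c * f \<omega>)"
  by (auto simp: square_integrable_def power_mult_distrib)

lemma square_integrable_add:
  assumes f: "square_integrable M f" and g: "square_integrable M g"
  shows "square_integrable M (\<lambda>\<omega>. f \<omega> + g \<omega>)"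
proof -
  have "integrable M (\<lambda>\<omega>. (f \<omega>)\<^sup>2 + (g \<omega>)\<^sup>2 + 2 * (f \<omega> * g \<omega>))"
    using f g square_integrable_integrable_mult[OF f g] by (simp add: square_integrable_def)
  then show ?thesis
    using f g by (auto simp: square_integrable_def power2_sum mult.assoc)
qed

lemma square_integrable_diff:
  assumes f: "square_integrable M f" and g: "square_integrable M g"
  shows "square_integrable M (\<lambda>\<omega>. f \<omega> - g \<omega>)"
  using square_integrable_add[OF f square_integrable_cmult[OF g, of "-1"]] by simp

lemma square_integrable_cong_AE:
  assumes "square_integrable M f" "g \<in> borel_measurable M" "AE \<omega> in M. g \<omega> = f \<omega>"
  shows "square_integrable M g"
proof -
  have "integrable M (\<lambda>\<omega>. (g \<omega>)\<^sup>2) \<longleftrightarrow> integrable M (\<lambda>\<omega>. (f \<omega>)\<^sup>2)"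
    by (rule integrable_cong_AE) (use assms in \<open>auto simp: square_integrable_def\<close>)
  with assms show ?thesis by (simp add: square_integrable_def)
qed

text \<open>
  Conditioning on \<open>X\<close> is an orthogonal projection: a function \<open>g (X)\<close> is measurable for the
  \<open>\<sigma>\<close>-algebra generated by \<open>X\<close>, so it has the same inner product with \<open>Y\<close> as with \<open>E (Y | X)\<close>.
\<close>

lemma integral_times_cond_exp_given:
  assumes "finite_measure M" and X: "X \<in> M \<rightarrow>\<^sub>M F" and g: "g \<in> borel_measurable F"
    and gX: "square_integrable M (\<lambda>\<omega>. g (X \<omega>))" and Y: "square_integrable M Y"
  shows "(\<integral>\<omega>. g (X \<omega>) * cond_exp_given M F X Y \<omega> \<partial>M) = (\<integral>\<omega>. g (X \<omega>) * Y \<omega> \<partial>M)"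
proof -
  let ?G = "vimage_algebra (space M) X F"
  have "sets ?G \<subseteq> sets M"
    using X by (auto simp: sets_vimage_algebra2[OF funcsetI[OF measurable_space[OF X]]]
        intro: measurable_sets)
  then have "subalgebra M ?G"
    by (simp add: subalgebra_def)
  then interpret finite_measure_subalgebra M ?G
    using assms(1) by (simp add: finite_measure_subalgebra_def finite_measure_subalgebra_axioms_def)
  have "X \<in> ?G \<rightarrow>\<^sub>M F"
    using measurable_space[OF X] by (intro measurable_vimage_algebra1 funcsetI)
  then have "(\<lambda>\<omega>. g (X \<omega>)) \<in> borel_measurable ?G"
    using g by (rule measurable_compose)
  then show ?thesis
    unfolding cond_exp_given_def
    by (rule real_cond_exp_intg(2)[OF square_integrable_integrable_mult[OF gX Y] _
          square_integrable_measurable[OF Y]])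
qed

text \<open>Pythagoras for the pairwise orthogonal functions \<open>D\<close>, \<open>1\<close> and \<open>R\<close>.\<close>

lemma integral_square_orthogonal_sum:
  assumes "prob_space M" and D: "square_integrable M D" and R: "square_integrable M R"
    and D0: "(\<integral>\<omega>. D \<omega> \<partial>M) = 0" and R0: "(\<integral>\<omega>. R \<omega> \<partial>M) = 0"
    and DR: "(\<integral>\<omega>. D \<omega> * R \<omega> \<partial>M) = 0"
  shows "(\<integral>\<omega>. (a * D \<omega> + b + R \<omega>)\<^sup>2 \<partial>M) = a\<^sup>2 * (\<integral>\<omega>. (D \<omega>)\<^sup>2 \<partial>M) + b\<^sup>2 + (\<integral>\<omega>. (R \<omega>)\<^sup>2 \<partial>M)"
proof -
  interpret prob_space M by fact
  have *: "(a * D \<omega> + b + R \<omega>)\<^sup>2 = a\<^sup>2 * (D \<omega>)\<^sup>2 + b\<^sup>2 + (R \<omega>)\<^sup>2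
      + 2 * a * b * D \<omega> + 2 * a * (D \<omega> * R \<omega>) + 2 * b * R \<omega>" for \<omega>
    by (simp add: power2_eq_square algebra_simps)
  have [simp]: "integrable M (\<lambda>\<omega>. (D \<omega>)\<^sup>2)" "integrable M (\<lambda>\<omega>. (R \<omega>)\<^sup>2)"
      "integrable M D" "integrable M R" "integrable M (\<lambda>\<omega>. D \<omega> * R \<omega>)"
    using D R square_integrable_integrable[OF finite_measure_axioms D]
      square_integrable_integrable[OF finite_measure_axioms R]
      square_integrable_integrable_mult[OF D R]
    by (simp_all add: square_integrable_def)
  show ?thesis
    unfolding * by (simp add: D0 R0 DR prob_space)
qed

text \<open>
  The two risks without their common residual term, with \<open>V = E D\<^sup>2\<close> and \<open>\<delta> = \<theta>\<^sub>0 - \<theta>\<close>. Their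
  difference contains the positive factor \<open>d\<^sup>2 (1 - \<alpha>)\<close>, because
  \<open>1 - \<alpha>\<^sup>2 = (1 - \<alpha>) (1 + \<alpha>)\<close>; this is why \<open>d\<close> does not enter the bound.
\<close>

lemma shrinkage_risk_le_iff:
  fixes d \<alpha> \<delta> V :: real
  assumes "d \<noteq> 0" "0 < \<alpha>" "\<alpha> < 1"
  shows "(\<alpha> * d)\<^sup>2 * V + ((1 - \<alpha>) * d * \<delta>)\<^sup>2 \<le> d\<^sup>2 * V
    \<longleftrightarrow> \<bar>\<delta>\<bar> \<le> sqrt ((1 + \<alpha>) / (1 - \<alpha>)) * sqrt V"
proof -
  have "d\<^sup>2 * V - ((\<alpha> * d)\<^sup>2 * V + ((1 - \<alpha>) * d * \<delta>)\<^sup>2)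
      = (d\<^sup>2 * (1 - \<alpha>)) * ((1 + \<alpha>) * V - (1 - \<alpha>) * \<delta>\<^sup>2)"
    by (simp add: power2_eq_square algebra_simps)
  moreover have "0 < d\<^sup>2 * (1 - \<alpha>)"
    using assms by simp
  ultimately have "(\<alpha> * d)\<^sup>2 * V + ((1 - \<alpha>) * d * \<delta>)\<^sup>2 \<le> d\<^sup>2 * V
      \<longleftrightarrow> 0 \<le> (1 + \<alpha>) * V - (1 - \<alpha>) * \<delta>\<^sup>2"
    by (metis diff_ge_0_iff_ge mult_le_cancel_left_pos mult_zero_right)
  also have "\<dots> \<longleftrightarrow> \<delta>\<^sup>2 \<le> (1 + \<alpha>) / (1 - \<alpha>) * V"
    using assms by (simp add: field_simps)
  also have "\<dots> \<longleftrightarrow> sqrt (\<delta>\<^sup>2) \<le> sqrt ((1 + \<alpha>) / (1 - \<alpha>) * V)"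
    by (rule real_sqrt_le_iff[symmetric])
  finally show ?thesis
    by (simp only: real_sqrt_abs real_sqrt_mult)
qed

theorem lemma4p3:
  fixes \<Theta> :: "real set"
    and \<Omega> :: "'w measure" and P :: "real \<Rightarrow> 'w measure"
    and F :: "'f measure" and X :: "'w \<Rightarrow> 'f" and Y :: "'w \<Rightarrow> real"
    and m :: "'f \<Rightarrow> real \<Rightarrow> real"
    and A \<theta>bar p p\<^sub>0 :: "'f \<Rightarrow> real"
    and d \<alpha> \<theta>\<^sub>0 :: real
  assumes "open \<Theta>"
    and "\<And>\<theta>. \<theta> \<in> \<Theta> \<Longrightarrow> prob_space (P \<theta>)"
    and "\<And>\<theta>. \<theta> \<in> \<Theta> \<Longrightarrow> sets (P \<theta>) = sets \<Omega>"
    and "X \<in> \<Omega> \<rightarrow>\<^sub>M F"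
    and "Y \<in> borel_measurable \<Omega>"
    and "A \<in> borel_measurable F"
    and "\<theta>bar \<in> borel_measurable F"
    and "p \<in> borel_measurable F"
    and "regression_function \<Theta> P F X Y m"
    and "\<And>\<theta>. \<theta> \<in> \<Theta> \<Longrightarrow> square_integrable (P \<theta>) Y"
    and "\<And>\<theta>. \<theta> \<in> \<Theta> \<Longrightarrow> square_integrable (P \<theta>) (\<lambda>\<omega>. p (X \<omega>))"
    and "\<And>\<theta>. \<theta> \<in> \<Theta> \<Longrightarrow> square_integrable (P \<theta>) (\<lambda>\<omega>. p\<^sub>0 (X \<omega>))"
    and "d \<noteq> 0"
    and "\<And>\<theta> \<theta>'. \<theta> \<in> \<Theta> \<Longrightarrow> \<theta>' \<in> \<Theta> \<Longrightarrow> AE \<omega> in P \<theta>'. m (X \<omega>) \<theta> = A (X \<omega>) + d * \<theta>"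
    and "unbiased_predictor \<Theta> P X Y p"
    and "\<And>\<theta>. \<theta> \<in> \<Theta> \<Longrightarrow> AE \<omega> in P \<theta>. p (X \<omega>) = A (X \<omega>) + d * \<theta>bar (X \<omega>)"
    and "\<theta>\<^sub>0 \<in> \<Theta>"
    and "0 < \<alpha>" and "\<alpha> < 1"
    and "\<And>x. p\<^sub>0 x = \<alpha> * p x + (1 - \<alpha>) * m x \<theta>\<^sub>0"
  shows "\<forall>\<theta>\<in>\<Theta>. preferable (P \<theta>) X Y p\<^sub>0 p \<longleftrightarrow>
           \<bar>\<theta> - \<theta>\<^sub>0\<bar> \<le> sqrt ((1 + \<alpha>) / (1 - \<alpha>)) * sqrt (\<integral>\<omega>. (\<theta>bar (X \<omega>) - \<theta>)\<^sup>2 \<partial>P \<theta>)"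
proof
  fix \<theta> assume \<theta>: "\<theta> \<in> \<Theta>"
  interpret prob_space "P \<theta>" using assms(2) \<theta> .
  let ?sq = "square_integrable (P \<theta>)"
  define D where "D \<omega> = \<theta>bar (X \<omega>) - \<theta>" for \<omega>
  define R where "R \<omega> = A (X \<omega>) + d * \<theta> - Y \<omega>" for \<omega>

  have X: "X \<in> P \<theta> \<rightarrow>\<^sub>M F"
    using assms(3,4) \<theta> by (simp cong: measurable_cong_sets)
  note [measurable] = X assms(6-8)
  have [measurable]: "Y \<in> borel_measurable (P \<theta>)"
    using assms(5) assms(3)[OF \<theta>] by (simp cong: measurable_cong_sets)
  have sqY: "?sq Y" and sqp: "?sq (\<lambda>\<omega>. p (X \<omega>))" and sqp0: "?sq (\<lambda>\<omega>. p\<^sub>0 (X \<omega>))"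
    using assms(10-12) \<theta> by auto
  have const: "?sq (\<lambda>_. c)" for c
    by (rule square_integrable_const[OF finite_measure_axioms])
  have p: "AE \<omega> in P \<theta>. p (X \<omega>) = A (X \<omega>) + d * \<theta>bar (X \<omega>)"
    using assms(16) \<theta> .
  have m0: "AE \<omega> in P \<theta>. m (X \<omega>) \<theta>\<^sub>0 = A (X \<omega>) + d * \<theta>\<^sub>0"
    using assms(14)[OF assms(17) \<theta>] .

  \<comment> \<open>\<open>A (X)\<close> inherits square integrability from \<open>p\<close> and \<open>p\<^sub>0\<close>: since \<open>\<alpha> \<noteq> 1\<close>, the relation between
    the two predictors can be solved for \<open>m (X, \<theta>\<^sub>0)\<close>.\<close>
  have sqA: "?sq (\<lambda>\<omega>. A (X \<omega>))"
  proof (rule square_integrable_cong_AE)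
    show "?sq (\<lambda>\<omega>. 1 / (1 - \<alpha>) * (p\<^sub>0 (X \<omega>) - \<alpha> * p (X \<omega>)) - d * \<theta>\<^sub>0)"
      by (intro square_integrable_diff square_integrable_cmult sqp sqp0 const)
    show "AE \<omega> in P \<theta>. A (X \<omega>) = 1 / (1 - \<alpha>) * (p\<^sub>0 (X \<omega>) - \<alpha> * p (X \<omega>)) - d * \<theta>\<^sub>0"
      using m0
    proof eventually_elim
      case (elim \<omega>)
      then show ?case
        using assms(19) by (simp add: assms(20) field_simps)
    qed
  qed measurable
  have sqD: "?sq D"
  proof (rule square_integrable_cong_AE)
    show "?sq (\<lambda>\<omega>. 1 / d * (p (X \<omega>) - A (X \<omega>)) - \<theta>)"
      by (intro square_integrable_diff square_integrable_cmult sqp sqA const)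
    show "AE \<omega> in P \<theta>. D \<omega> = 1 / d * (p (X \<omega>) - A (X \<omega>)) - \<theta>"
      using p by eventually_elim (simp add: D_def assms(13))
    show "D \<in> borel_measurable (P \<theta>)"
      unfolding D_def by measurable
  qed
  have sqm: "?sq (\<lambda>\<omega>. A (X \<omega>) + d * \<theta>)"
    by (intro square_integrable_add sqA const)
  have sqR: "?sq R"
    unfolding R_def by (intro square_integrable_diff sqm sqY)

  have m: "AE \<omega> in P \<theta>. cond_exp_given (P \<theta>) F X Y \<omega> = A (X \<omega>) + d * \<theta>"
  proof -
    have "AE \<omega> in P \<theta>. m (X \<omega>) \<theta> = cond_exp_given (P \<theta>) F X Y \<omega>"
      using assms(9) \<theta> by (simp add: regression_function_def)
    then show ?thesis
      using assms(14)[OF \<theta> \<theta>] by eventually_elim simp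
  qed
  have orth: "(\<integral>\<omega>. g (X \<omega>) * R \<omega> \<partial>P \<theta>) = 0"
    if g: "g \<in> borel_measurable F" and gX: "?sq (\<lambda>\<omega>. g (X \<omega>))" for g
  proof -
    note [measurable] = g
    have [measurable]: "cond_exp_given (P \<theta>) F X Y \<in> borel_measurable (P \<theta>)"
      by (simp add: cond_exp_given_def)
    have "(\<integral>\<omega>. g (X \<omega>) * Y \<omega> \<partial>P \<theta>) = (\<integral>\<omega>. g (X \<omega>) * cond_exp_given (P \<theta>) F X Y \<omega> \<partial>P \<theta>)"
      by (rule integral_times_cond_exp_given[OF finite_measure_axioms X g gX sqY, symmetric])
    also have "\<dots> = (\<integral>\<omega>. g (X \<omega>) * (A (X \<omega>) + d * \<theta>) \<partial>P \<theta>)"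
      by (rule integral_cong_AE; measurable?) (use m in eventually_elim, simp)
    finally show ?thesis
      using square_integrable_integrable_mult[OF gX sqm]
        square_integrable_integrable_mult[OF gX sqY]
      by (simp add: R_def right_diff_distrib)
  qed
  have R0: "(\<integral>\<omega>. R \<omega> \<partial>P \<theta>) = 0"
    using orth[of "\<lambda>_. 1"] const by simp
  have DR: "(\<integral>\<omega>. D \<omega> * R \<omega> \<partial>P \<theta>) = 0"
    using orth[of "\<lambda>x. \<theta>bar x - \<theta>"] sqD by (simp add: D_def[abs_def])

  have err: "AE \<omega> in P \<theta>. p (X \<omega>) - Y \<omega> = d * D \<omega> + 0 + R \<omega>"
    using p by eventually_elim (simp add: D_def R_def algebra_simps)
  have err0: "AE \<omega> in P \<theta>. p\<^sub>0 (X \<omega>) - Y \<omega> = (\<alpha> * d) * D \<omega> + (1 - \<alpha>) * d * (\<theta>\<^sub>0 - \<theta>) + R \<omega>"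
    using p m0 by eventually_elim (simp add: assms(20) D_def R_def algebra_simps)
  have [measurable]: "D \<in> borel_measurable (P \<theta>)" "R \<in> borel_measurable (P \<theta>)"
      "(\<lambda>\<omega>. p\<^sub>0 (X \<omega>)) \<in> borel_measurable (P \<theta>)"
    using sqD sqR sqp0 by (simp_all add: square_integrable_measurable)
  have int: "integrable (P \<theta>) D" "integrable (P \<theta>) R" "integrable (P \<theta>) Y"
      "integrable (P \<theta>) (\<lambda>\<omega>. p (X \<omega>))"
    by (rule square_integrable_integrable[OF finite_measure_axioms], fact)+

  have D0: "(\<integral>\<omega>. D \<omega> \<partial>P \<theta>) = 0"
  proof -
    have "0 = (\<integral>\<omega>. p (X \<omega>) - Y \<omega> \<partial>P \<theta>)"
      using assms(15) \<theta> int by (simp add: unbiased_predictor_def)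
    also have "\<dots> = (\<integral>\<omega>. d * D \<omega> + 0 + R \<omega> \<partial>P \<theta>)"
      by (rule integral_cong_AE; measurable?) (rule err)
    also have "\<dots> = d * (\<integral>\<omega>. D \<omega> \<partial>P \<theta>)"
      using int R0 by simp
    finally show ?thesis
      using assms(13) by simp
  qed

  note pythagoras = integral_square_orthogonal_sum[OF prob_space_axioms sqD sqR D0 R0 DR]
  let ?V = "\<integral>\<omega>. (D \<omega>)\<^sup>2 \<partial>P \<theta>" and ?S = "\<integral>\<omega>. (R \<omega>)\<^sup>2 \<partial>P \<theta>"
  have "(\<integral>\<omega>. (p (X \<omega>) - Y \<omega>)\<^sup>2 \<partial>P \<theta>) = (\<integral>\<omega>. (d * D \<omega> + 0 + R \<omega>)\<^sup>2 \<partial>P \<theta>)"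
    by (rule integral_cong_AE; measurable?) (use err in eventually_elim, simp)
  then have risk: "(\<integral>\<omega>. (p (X \<omega>) - Y \<omega>)\<^sup>2 \<partial>P \<theta>) = d\<^sup>2 * ?V + ?S"
    unfolding pythagoras by simp
  have "(\<integral>\<omega>. (p\<^sub>0 (X \<omega>) - Y \<omega>)\<^sup>2 \<partial>P \<theta>)
      = (\<integral>\<omega>. ((\<alpha> * d) * D \<omega> + (1 - \<alpha>) * d * (\<theta>\<^sub>0 - \<theta>) + R \<omega>)\<^sup>2 \<partial>P \<theta>)"
    by (rule integral_cong_AE; measurable?) (use err0 in eventually_elim, simp)
  then have risk0: "(\<integral>\<omega>. (p\<^sub>0 (X \<omega>) - Y \<omega>)\<^sup>2 \<partial>P \<theta>)
      = (\<alpha> * d)\<^sup>2 * ?V + ((1 - \<alpha>) * d * (\<theta>\<^sub>0 - \<theta>))\<^sup>2 + ?S"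
    unfolding pythagoras .
  show "preferable (P \<theta>) X Y p\<^sub>0 p \<longleftrightarrow>
      \<bar>\<theta> - \<theta>\<^sub>0\<bar> \<le> sqrt ((1 + \<alpha>) / (1 - \<alpha>)) * sqrt (\<integral>\<omega>. (\<theta>bar (X \<omega>) - \<theta>)\<^sup>2 \<partial>P \<theta>)"
    using shrinkage_risk_le_iff[OF assms(13,18,19), of ?V "\<theta>\<^sub>0 - \<theta>"]
    unfolding preferable_def risk risk0 by (simp add: D_def abs_minus_commute)
qed

end
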